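(* Let $X\subset\{0,1\}^{\mathbb{N}}$ be the shift space $X=\overline{\bigcup_{n\ge0}X_n}$ defined in the context. Then $X$ has topological entropy zero, i.e. $h(X)=0$.
   Context: $\mathbb{N}=\{1,2,\dots\}$; $\{0,1\}^{\mathbb{N}}$ carries the product topology and $\sigma$ is the shift map, $\sigma(x)_i=x_{i+1}$. A shift space is a closed $\sigma$-invariant subset. $h(X)=\lim_{n\to\infty}\frac1n\log|\mathcal{B}_n(X)|$, where $\mathcal{B}_n(X)$ is the set of all blocks of length $n$ occurring in points of $X$. For blocks, $u^\infty=uuu\dots$, $0^\alpha$ is the block of $\alpha$ zeros ($0^0$ is the empty block), and $\|u\|_1$ is the number of $1$'s in $u$. A block is a from-$1$-to-$1$ word if it equals $1$ or has the form $1v1$ with $v\in\{0,1\}^*$ (possibly empty). For a shift space $Y\subset\{0,1\}^{\mathbb{N}}$, $\mathcal{G}_m(Y)$ is the set of all from-$1$-to-$1$ words $u$ that occur in some point of $Y$ and satisfy $\|u\|_1\le m$. Construction of $X$: let $X_0=\{0^\infty\}\cup\{0^\alpha10^\infty:\alpha\ge0\}$. Given $X_n$ ($n\ge0$), let $$P_{n+1}=\bigcup_{l=0}^\infty\sigma^l\big(\{(u0^k)^\infty:k\ge2^{2n},\ u\in\mathcal{G}_{2^n}(X_n)\}\big),$$ $$J'_{n+1}=\{0^\alpha u0^\infty:\alpha\ge0,\ u\in\mathcal{G}_{2^n}(X_n)\},$$ $$J''_{n+1}=\{0^\alpha u0^\beta v0^\infty:\alpha\ge0,\ \beta\ge2^{2n},\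 u,v\in\mathcal{G}_{2^n}(X_n)\},$$ $J_{n+1}=J'_{n+1}\cup J''_{n+1}$, $Y_{n+1}=\overline{P_{n+1}\cup J_{n+1}}$, and $X_{n+1}=X_n\cup Y_{n+1}$. Finally $X=\overline{\bigcup_{n=0}^\infty X_n}$. *)

theory Defs
  imports "HOL-Analysis.Analysis" "HOL-Library.Omega_Words_Fun"
begin

text \<open>
  The symbols 1 and 0 are \<^term>\<open>True\<close> and \<^term>\<open>False\<close>; blocks have type \<^typ>\<open>bool list\<close> and points of
  the full shift have type \<^typ>\<open>bool word\<close>, that is \<^typ>\<open>nat \<Rightarrow> bool\<close>. Coordinates are numbered
  from 0 instead of from 1. The topology is the product topology of the type class instance for
  functions, with \<^typ>\<open>bool\<close> discrete.
\<close>

subsection \<open>Shift spaces and topological entropy\<close>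

definition shift :: "bool word \<Rightarrow> bool word" where
  "shift = suffix 1"

definition shift_space :: "bool word set \<Rightarrow> bool" where
  "shift_space X \<longleftrightarrow> closed X \<and> shift ` X \<subseteq> X"

definition occurs_in :: "bool list \<Rightarrow> bool word \<Rightarrow> bool" where
  "occurs_in u x \<longleftrightarrow> (\<exists>i. subsequence x i (i + length u) = u)"

definition blocks :: "nat \<Rightarrow> bool word set \<Rightarrow> bool list set" where
  "blocks n X = {u. length u = n \<and> (\<exists>x\<in>X. occurs_in u x)}"

definition topological_entropy :: "bool word set \<Rightarrow> real" where
  "topological_entropy X = lim (\<lambda>n. ln (real (card (blocks n X))) / real n)"

subsection \<open>The construction\<close>

abbreviation zeros :: "nat \<Rightarrow> bool list" where
  "zeros n \<equiv> replicate n False"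

definition zero_word :: "bool word" where
  "zero_word = [False]\<^sup>\<omega>"

definition from_1_to_1 :: "bool list \<Rightarrow> bool" where
  "from_1_to_1 u \<longleftrightarrow> u = [True] \<or> (\<exists>v. u = [True] @ v @ [True])"

definition G :: "nat \<Rightarrow> bool word set \<Rightarrow> bool list set" where
  "G m Y = {u. from_1_to_1 u \<and> (\<exists>y\<in>Y. occurs_in u y) \<and> count_list u True \<le> m}"

text \<open>
  In the next four definitions \<open>Y\<close> is the stage with index \<open>n\<close>, and the set that is defined
  is used for the stage with index \<open>n + 1\<close>.
\<close>

definition P_next :: "nat \<Rightarrow> bool word set \<Rightarrow> bool word set" where
  "P_next n Y = (\<Union>l. (shift ^^ l) ` {(u @ zeros k)\<^sup>\<omega> | u k. 2 ^ (2 * n) \<le> k \<and> u \<in> G (2 ^ n) Y})"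

definition J1_next :: "nat \<Rightarrow> bool word set \<Rightarrow> bool word set" where
  "J1_next n Y = {(zeros a @ u) \<frown> zero_word | a u. u \<in> G (2 ^ n) Y}"

definition J2_next :: "nat \<Rightarrow> bool word set \<Rightarrow> bool word set" where
  "J2_next n Y = {(zeros a @ u @ zeros b @ v) \<frown> zero_word | a b u v.
     2 ^ (2 * n) \<le> b \<and> u \<in> G (2 ^ n) Y \<and> v \<in> G (2 ^ n) Y}"

definition Y_next :: "nat \<Rightarrow> bool word set \<Rightarrow> bool word set" where
  "Y_next n Y = closure (P_next n Y \<union> (J1_next n Y \<union> J2_next n Y))"

primrec X_stage :: "nat \<Rightarrow> bool word set" where
  "X_stage 0 = {zero_word} \<union> {(zeros a @ [True]) \<frown> zero_word | a. True}"
| "X_stage (Suc n) = X_stage n \<union> Y_next n (X_stage n)"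

definition X_limit :: "bool word set" where
  "X_limit = closure (\<Union>n. X_stage n)"

subsection \<open>The limit is a shift space\<close>

lemma zero_word_nth [simp]: "zero_word i = False"
  by (simp add: zero_word_def)

lemma shift_zero_word [simp]: "shift zero_word = zero_word"
  by (auto simp: shift_def)

lemma shift_conc: "u \<noteq> [] \<Longrightarrow> shift (u \<frown> x) = tl u \<frown> x"
  by (cases u) (auto simp: shift_def simp del: build_cons)

lemma continuous_on_shift: "continuous_on S shift"
proof -
  have "continuous_on UNIV shift"
    unfolding shift_def suffix_def
    by (rule continuous_on_coordinatewise_then_product) (rule continuous_on_product_coordinates)
  then show ?thesis
    by (rule continuous_on_subset) simp
qed

lemma occurs_in_drop:
  assumes "occurs_in u x"
  shows "occurs_in (drop k u) x"
proof (cases "k \<le> length u")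
  case True
  obtain i where i: "subsequence x i (i + length u) = u"
    using assms by (auto simp: occurs_in_def)
  then have "drop k u = subsequence x (i + k) (i + length u)"
    by (metis subsequence_drop)
  moreover have "i + length u = (i + k) + length (drop k u)"
    using True by simp
  ultimately show ?thesis
    unfolding occurs_in_def by metis
qed (auto simp: occurs_in_def)

lemma G_tl:
  assumes "u \<in> G m Y" "u \<noteq> [True]"
  obtains a u' where "tl u = zeros a @ u'" "u' \<in> G m Y"
proof -
  obtain v where v: "u = True # v @ [True]"
    using assms by (auto simp: G_def from_1_to_1_def)
  define u' where "u' = dropWhile Not (v @ [True])"
  define z where "z = takeWhile Not (v @ [True])"
  have split: "v @ [True] = z @ u'"
    by (simp add: u'_def z_def)
  have z: "z = zeros (length z)"
    by (metis (full_types) replicate_length_same set_takeWhileD z_def)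
  have "u' \<noteq> []"
    by (simp add: u'_def)
  then have hd: "hd u' = True"
    using hd_dropWhile[of Not "v @ [True]"] by (simp add: u'_def)
  have last: "last u' = True"
    using split \<open>u' \<noteq> []\<close> by (metis last_appendR last_snoc)
  have "from_1_to_1 u'"
  proof (cases "tl u' = []")
    case True
    then have "u' = [True]"
      using \<open>u' \<noteq> []\<close> hd by (cases u') auto
    then show ?thesis by (simp add: from_1_to_1_def)
  next
    case False
    then have "u' = [True] @ butlast (tl u') @ [True]"
      using \<open>u' \<noteq> []\<close> hd last append_butlast_last_id[OF False] by (cases u') auto
    then show ?thesis unfolding from_1_to_1_def by blast
  qed
  moreover have "u' = drop (Suc (length z)) u"
    using v split by simp
  then have "occurs_in u y \<Longrightarrow> occurs_in u' y" for y
    using occurs_in_drop by blast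
  moreover have "count_list u' True \<le> count_list u True"
    using v split by simp
  ultimately have "u' \<in> G m Y"
    using assms by (fastforce simp: G_def)
  moreover have "tl u = zeros (length z) @ u'"
    using v split z by simp
  ultimately show thesis using that by blast
qed

lemma shift_P_next: "shift ` P_next n Y \<subseteq> P_next n Y"
proof (rule image_subsetI)
  fix x assume "x \<in> P_next n Y"
  then obtain l z where z: "z \<in> {(u @ zeros k)\<^sup>\<omega> | u k. 2 ^ (2 * n) \<le> k \<and> u \<in> G (2 ^ n) Y}"
    and x: "x = (shift ^^ l) z"
    unfolding P_next_def by blast
  have "shift x = (shift ^^ Suc l) z"
    by (simp add: x)
  then show "shift x \<in> P_next n Y"
    using z unfolding P_next_def by blast
qed

lemma shift_J1_next: "shift ` J1_next n Y \<subseteq> insert zero_word (J1_next n Y)"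
proof (rule image_subsetI)
  fix x assume "x \<in> J1_next n Y"
  then obtain a u where x: "x = (zeros a @ u) \<frown> zero_word" and u: "u \<in> G (2 ^ n) Y"
    by (auto simp: J1_next_def)
  have "u \<noteq> []"
    using u by (auto simp: G_def from_1_to_1_def)
  show "shift x \<in> insert zero_word (J1_next n Y)"
  proof (cases a)
    case (Suc a')
    then have "shift x = (zeros a' @ u) \<frown> zero_word"
      unfolding x by (subst shift_conc) auto
    then show ?thesis using u unfolding J1_next_def by blast
  next
    case 0
    then have tl: "shift x = tl u \<frown> zero_word"
      unfolding x using \<open>u \<noteq> []\<close> by (simp add: shift_conc)
    show ?thesis
    proof (cases "u = [True]")
      case True
      then show ?thesis using tl by simp
    next
      case False
      then obtain c u' where "tl u = zeros c @ u'" "u' \<in> G (2 ^ n) Y"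
        using G_tl[OF u] by blast
      then show ?thesis using tl unfolding J1_next_def by auto
    qed
  qed
qed

lemma shift_J2_next: "shift ` J2_next n Y \<subseteq> J1_next n Y \<union> J2_next n Y"
proof (rule image_subsetI)
  fix x assume "x \<in> J2_next n Y"
  then obtain a u b v where x: "x = (zeros a @ u @ zeros b @ v) \<frown> zero_word"
    and b: "2 ^ (2 * n) \<le> b" and u: "u \<in> G (2 ^ n) Y" and v: "v \<in> G (2 ^ n) Y"
    by (auto simp: J2_next_def)
  have "u \<noteq> []"
    using u by (auto simp: G_def from_1_to_1_def)
  show "shift x \<in> J1_next n Y \<union> J2_next n Y"
  proof (cases a)
    case (Suc a')
    then have "shift x = (zeros a' @ u @ zeros b @ v) \<frown> zero_word"
      unfolding x by (subst shift_conc) auto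
    then show ?thesis using b u v unfolding J2_next_def by blast
  next
    case 0
    then have tl: "shift x = (tl u @ zeros b @ v) \<frown> zero_word"
      unfolding x using \<open>u \<noteq> []\<close> by (simp add: shift_conc del: conc_conc)
    show ?thesis
    proof (cases "u = [True]")
      case True
      then have "shift x = (zeros b @ v) \<frown> zero_word"
        using tl by simp
      then show ?thesis using v unfolding J1_next_def by blast
    next
      case False
      then obtain c u' where c: "tl u = zeros c @ u'" and u': "u' \<in> G (2 ^ n) Y"
        using G_tl[OF u] by blast
      have "shift x = (zeros c @ u' @ zeros b @ v) \<frown> zero_word"
        using tl c by simp
      then show ?thesis using b u' v unfolding J2_next_def by blast
    qed
  qed
qed

lemma X_stage_subset_X_limit: "X_stage n \<subseteq> X_limit"
  unfolding X_limit_def by (rule subset_trans[OF UN_upper closure_subset]) simp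

lemma zero_word_in_X_limit: "zero_word \<in> X_limit"
proof -
  have "zero_word \<in> X_stage 0"
    unfolding X_stage.simps by blast
  then show ?thesis
    using X_stage_subset_X_limit[of 0] by (rule subsetD[rotated])
qed

lemma closed_X_limit: "closed X_limit"
  by (simp add: X_limit_def)

lemma shift_X_stage: "shift ` X_stage n \<subseteq> X_limit"
proof (induction n)
  case 0
  have "shift x \<in> X_stage 0" if x: "x \<in> X_stage 0" for x
  proof -
    have "x = zero_word \<or> (\<exists>a. x = (zeros a @ [True]) \<frown> zero_word)"
      using x unfolding X_stage.simps by blast
    then consider "x = zero_word" | "x = [True] \<frown> zero_word"
      | a where "x = (zeros (Suc a) @ [True]) \<frown> zero_word"
      by (metis append_Nil not0_implies_Suc replicate_0)
    then show ?thesis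
    proof cases
      case 1
      then have "shift x = zero_word" by (simp only: shift_zero_word)
      then show ?thesis unfolding X_stage.simps by blast
    next
      case 2
      then have "shift x = zero_word" by (simp only: shift_conc list.sel conc_empty list.distinct not_False_eq_True)
      then show ?thesis unfolding X_stage.simps by blast
    next
      case 3
      then have "shift x = (zeros a @ [True]) \<frown> zero_word"
        by (simp only: shift_conc replicate_Suc append_Cons list.sel list.distinct not_False_eq_True)
      then show ?thesis unfolding X_stage.simps by blast
    qed
  qed
  then show ?case using X_stage_subset_X_limit[of 0] by (simp only: image_subset_iff subset_iff) blast
next
  case (Suc n)
  let ?S = "P_next n (X_stage n) \<union> (J1_next n (X_stage n) \<union> J2_next n (X_stage n))"
  have "?S \<subseteq> X_stage (Suc n)"
    using closure_subset[of ?S] by (simp only: X_stage.simps Y_next_def le_supI2)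
  then have "insert zero_word ?S \<subseteq> X_limit"
    using X_stage_subset_X_limit[of "Suc n"] zero_word_in_X_limit
    by (meson insert_subset subset_trans)
  moreover have "shift ` ?S \<subseteq> insert zero_word ?S"
    unfolding image_Un
    using shift_P_next[of n "X_stage n"] shift_J1_next[of n "X_stage n"]
      shift_J2_next[of n "X_stage n"]
    by (intro Un_least) auto
  ultimately have "shift ` ?S \<subseteq> X_limit"
    by (rule subset_trans[rotated])
  then have "shift ` closure ?S \<subseteq> X_limit"
    by (rule image_closure_subset[OF continuous_on_shift closed_X_limit])
  then show ?case
    using Suc unfolding X_stage.simps Y_next_def image_Un by (rule Un_least[rotated])
qed

theorem shift_space_X_limit: "shift_space X_limit"
proof -
  have "shift ` (\<Union>n. X_stage n) \<subseteq> X_limit"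
    using shift_X_stage by blast
  then have "shift ` X_limit \<subseteq> X_limit"
    using image_closure_subset[OF continuous_on_shift closed_X_limit, of "\<Union>n. X_stage n"]
    by (simp only: X_limit_def[symmetric])
  then show ?thesis
    by (simp add: shift_space_def closed_X_limit)
qed

subsection \<open>The limit that defines the entropy exists\<close>

lemma fekete:
  fixes a :: "nat \<Rightarrow> real"
  assumes nonneg: "\<And>n. 0 \<le> a n" and sub: "\<And>m n. a (m + n) \<le> a m + a n"
  shows "convergent (\<lambda>n. a n / real n)"
proof -
  define L where "L = (INF n\<in>{1..}. a n / real n)"
  have bdd: "bdd_below ((\<lambda>n. a n / real n) ` {1..})"
    using nonneg by (intro bdd_belowI[of _ 0]) auto
  have lower: "L \<le> a n / real n" if "n \<ge> 1" for n
    unfolding L_def using bdd that by (intro cINF_lower) auto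
  have mult: "a (q * k + r) \<le> real q * a k + a r" for q k r
  proof (induction q)
    case (Suc q)
    have "a (Suc q * k + r) \<le> a k + a (q * k + r)"
      using sub[of k "q * k + r"] by (simp add: add.assoc)
    then show ?case using Suc by (simp add: algebra_simps)
  qed simp
  have "(\<lambda>n. a n / real n) \<longlonglongrightarrow> L"
  proof (rule order_tendstoI)
    fix y assume "y < L"
    then show "\<forall>\<^sub>F n in sequentially. y < a n / real n"
      using lower by (intro eventually_sequentiallyI[of 1]) force
  next
    fix y assume "L < y"
    then obtain k where k: "k \<ge> 1" "a k / real k < y"
      unfolding L_def using bdd by (subst (asm) cINF_less_iff) auto
    define C where "C = Max (a ` {..<k})"
    have C: "a r \<le> C" if "r < k" for r
      unfolding C_def using that by (intro Max_ge) auto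
    have "(\<lambda>n. a k / real k + C / real n) \<longlonglongrightarrow> a k / real k + 0"
      by (intro tendsto_intros lim_const_over_n)
    then have "\<forall>\<^sub>F n in sequentially. a k / real k + C / real n < y"
      using k by (intro order_tendstoD(2)) auto
    then show "\<forall>\<^sub>F n in sequentially. a n / real n < y"
      using eventually_ge_at_top[of 1]
    proof eventually_elim
      case (elim n)
      have "a n \<le> real (n div k) * a k + a (n mod k)"
        using mult[of "n div k" k "n mod k"] by simp
      also have "real (n div k) * a k \<le> (real n / real k) * a k"
        using nonneg[of k] by (intro mult_right_mono of_nat_div_le_of_nat) auto
      also have "a (n mod k) \<le> C"
        using C k by simp
      finally have "a n \<le> (real n / real k) * a k + C" by simp
      then have "a n / real n \<le> ((real n / real k) * a k + C) / real n"
        by (intro divide_right_mono) auto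
      also have "\<dots> = a k / real k + C / real n"
        using elim k by (simp add: field_simps)
      finally show ?case using elim by simp
    qed
  qed
  then show ?thesis by (auto simp: convergent_def)
qed

lemma finite_blocks: "finite (blocks n X)"
  by (rule finite_subset[OF _ finite_lists_length_eq[of "UNIV :: bool set" n]])
    (auto simp: blocks_def)

lemma blocks_add: "blocks (m + n) X \<subseteq> (\<lambda>(u, v). u @ v) ` (blocks m X \<times> blocks n X)"
proof
  fix w assume w: "w \<in> blocks (m + n) X"
  then obtain x i where x: "x \<in> X" and i: "w = subsequence x i (i + (m + n))" and len: "length w = m + n"
    by (auto simp: blocks_def occurs_in_def)
  have "take m w = subsequence x i (i + m)"
    by (simp add: i)
  then have "take m w \<in> blocks m X"
    using x len by (auto simp: blocks_def occurs_in_def)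
  moreover have "drop m w \<in> blocks n X"
    using w len occurs_in_drop by (auto simp: blocks_def)
  ultimately show "w \<in> (\<lambda>(u, v). u @ v) ` (blocks m X \<times> blocks n X)"
    by (intro image_eqI[of _ _ "(take m w, drop m w)"]) auto
qed

lemma card_blocks_add: "card (blocks (m + n) X) \<le> card (blocks m X) * card (blocks n X)"
proof -
  have "card (blocks (m + n) X) \<le> card (blocks m X \<times> blocks n X)"
    by (rule surj_card_le[OF _ blocks_add]) (simp add: finite_blocks)
  then show ?thesis by (simp add: card_cartesian_product)
qed

lemma card_blocks_pos:
  assumes "X \<noteq> {}"
  shows "0 < card (blocks n X)"
proof -
  obtain x where "x \<in> X" using assms by blast
  then have "subsequence x 0 n \<in> blocks n X"
    unfolding blocks_def occurs_in_def by (auto intro!: exI[of _ 0] bexI[of _ x])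
  then show ?thesis using finite_blocks by (auto simp: card_gt_0_iff)
qed

theorem tendsto_topological_entropy:
  "(\<lambda>n. ln (real (card (blocks n X))) / real n) \<longlonglongrightarrow> topological_entropy X"
proof (cases "X = {}")
  case True
  then show ?thesis by (simp add: blocks_def topological_entropy_def)
next
  case False
  note pos = card_blocks_pos[OF False]
  have "ln (real (card (blocks (m + n) X)))
      \<le> ln (real (card (blocks m X))) + ln (real (card (blocks n X)))" for m n
  proof -
    have "ln (real (card (blocks (m + n) X))) \<le> ln (real (card (blocks m X) * card (blocks n X)))"
      using pos[of "m + n"] card_blocks_add[of m n X]
      by (subst ln_le_cancel_iff) (auto simp only: of_nat_le_iff of_nat_0_less_iff)
    then show ?thesis using pos[of m] pos[of n] by (simp add: ln_mult)
  qed
  moreover have "0 \<le> ln (real (card (blocks n X)))" for n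
    using pos[of n] by (intro ln_ge_zero) linarith
  ultimately show ?thesis
    unfolding topological_entropy_def by (intro convergent_LIMSEQ_iff[THEN iffD1] fekete)
qed

end

theory Submission
  imports Defs "HOL-Library.Sublist" "HOL-Real_Asymp.Real_Asymp"
begin

text \<open>
  Let \<open>c m\<close> be the number of words of length at most \<open>N\<close> in the \<open>m\<close>-th stage. A word that is new
  in stage \<open>m + 1\<close> either contains a whole period \<open>u 0\<^sup>k\<close>, or is composed of at most two words of
  stage \<open>m\<close> and three runs of zeros. So \<open>c (m + 1) \<le> M * (c m)\<^sup>2\<close> with \<open>M = 2 (N + 1)\<^sup>3\<close>, and \<open>c m\<close>
  is at most \<open>M\<close> to the power \<open>2 ^ (m + 1) - 1\<close>. If \<open>N \<le> 4 ^ m\<close>, the runs of zeros added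
  after stage \<open>m\<close> are too long for a word of length \<open>N\<close> to meet both neighbours of one of them, so later
  stages only pad the words of stage \<open>m\<close> with zeros. For \<open>N = 4 ^ m\<close> this bounds the logarithm of
  the number of \<open>N\<close>-blocks by \<open>2 ^ (m + 1) * ln M\<close>, which is of order \<open>sqrt N * ln N\<close>.
\<close>

subsection \<open>Words of a set of points\<close>

definition language :: "bool word set \<Rightarrow> bool list set" where
  "language Y = {w. \<exists>y\<in>Y. occurs_in w y}"

text \<open>All lengths up to \<open>N\<close> are counted together because the pieces into which a
  word is cut may be shorter than the word itself.\<close>

definition language_upto :: "nat \<Rightarrow> bool word set \<Rightarrow> bool list set" where
  "language_upto N Y = {w \<in> language Y. length w \<le> N}"

lemma finite_language_upto: "finite (language_upto N Y)"
  by (rule finite_subset[OF _ finite_lists_length_le[of "UNIV :: bool set" N]])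
    (auto simp: language_upto_def)

lemma Nil_in_language: "Y \<noteq> {} \<Longrightarrow> [] \<in> language Y"
  by (auto simp: language_def occurs_in_def)

lemma language_Un: "language (A \<union> B) = language A \<union> language B"
  by (auto simp: language_def)

lemma language_UN: "language (\<Union>i\<in>I. A i) = (\<Union>i\<in>I. language (A i))"
  by (auto simp: language_def)

lemma occurs_in_sublist:
  assumes "occurs_in w x" "sublist v w"
  shows "occurs_in v x"
proof -
  obtain ps ss where w: "w = ps @ v @ ss"
    using assms(2) by (auto simp: sublist_def)
  obtain i where i: "subsequence x i (i + length w) = w"
    using assms(1) by (auto simp: occurs_in_def)
  have "subsequence x (i + length ps) (i + length ps + length v) = v"
  proof (rule nth_equalityI)
    fix j assume "j < length (subsequence x (i + length ps) (i + length ps + length v))"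
    then have j: "j < length v" by simp
    have "w ! (length ps + j) = x (i + (length ps + j))"
      using j by (subst i[symmetric]) (simp add: w)
    then show "subsequence x (i + length ps) (i + length ps + length v) ! j = v ! j"
      using j by (simp add: w nth_append add.assoc)
  qed simp
  then show ?thesis by (auto simp: occurs_in_def)
qed

lemma sublist_in_language: "w \<in> language Y \<Longrightarrow> sublist v w \<Longrightarrow> v \<in> language Y"
  using occurs_in_sublist by (auto simp: language_def)

text \<open>A word occupies finitely many coordinates, so its occurrence at a fixed place is an open
  condition. Hence the closures in \<open>Y_next\<close> and \<open>X_limit\<close> add no
  words.\<close>

lemma language_closure: "language (closure Y) = language Y"
proof
  show "language (closure Y) \<subseteq> language Y"
  proof
    fix w assume "w \<in> language (closure Y)"
    then obtain x i where x: "x \<in> closure Y" and i: "subsequence x i (i + length w) = w"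
      by (auto simp: language_def occurs_in_def)
    \<comment> \<open>The cylinder of all points that agree with \<open>x\<close> on the window of
      \<open>w\<close>.\<close>
    let ?U = "\<Inter>j\<in>{i..<i + length w}. (\<lambda>y :: bool word. y j) -` {x j}"
    have "open ?U"
      by (intro open_INT ballI open_vimage continuous_on_product_coordinates)
        (auto simp: open_discrete)
    moreover have "x \<in> ?U" by simp
    ultimately obtain y where y: "y \<in> Y" "y \<in> ?U"
      using x by (meson IntE closure_iff_nhds_not_empty disjoint_iff subset_refl)
    then have "subsequence y i (i + length w) = subsequence x i (i + length w)"
      by (auto simp: subsequence_def)
    then show "w \<in> language Y"
      using y i by (auto simp: language_def occurs_in_def)
  qed
  show "language Y \<subseteq> language (closure Y)"
    using closure_subset[of Y] by (auto simp: language_def)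
qed

lemma occurs_in_shift_funpow: "occurs_in w ((shift ^^ l) x) \<Longrightarrow> occurs_in w x"
proof (induction l)
  case (Suc l)
  then obtain i where i: "subsequence (shift ((shift ^^ l) x)) i (i + length w) = w"
    by (auto simp: occurs_in_def)
  have "subsequence ((shift ^^ l) x) (Suc i) (Suc i + length w) = w"
    by (subst (2) i[symmetric]) (auto simp: shift_def intro!: nth_equalityI)
  then have "occurs_in w ((shift ^^ l) x)"
    unfolding occurs_in_def by blast
  then show ?case by (rule Suc.IH)
qed simp

lemma occurs_in_conc_zero_word:
  assumes "occurs_in w (xs \<frown> zero_word)"
  obtains c where "sublist w (xs @ zeros c)"
proof -
  obtain i where i: "subsequence (xs \<frown> zero_word) i (i + length w) = w"
    using assms by (auto simp: occurs_in_def)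
  let ?n = "i + length w"
  have "w = drop i (take ?n (xs @ zeros ?n))"
    by (subst i[symmetric], rule nth_equalityI) (auto simp: conc_def nth_append)
  then have "sublist w (xs @ zeros ?n)"
    by (metis sublist_drop sublist_order.order_trans sublist_take)
  then show thesis by (rule that)
qed

text \<open>The start can be reduced modulo the period. This leaves finitely many starts, as the
  counting requires.\<close>

lemma occurs_in_iter:
  assumes "occurs_in w (v\<^sup>\<omega>)" "v \<noteq> []"
  obtains i where "i < length v" "subsequence (v\<^sup>\<omega>) i (i + length w) = w"
proof -
  obtain i where i: "subsequence (v\<^sup>\<omega>) i (i + length w) = w"
    using assms by (auto simp: occurs_in_def)
  have "subsequence (v\<^sup>\<omega>) (i mod length v) (i mod length v + length w)
      = subsequence (v\<^sup>\<omega>) i (i + length w)"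
    using assms(2) by (intro nth_equalityI) (auto simp: mod_simps)
  also have "\<dots> = w"
    by (rule i)
  finally show thesis
    using assms(2) by (intro that[of "i mod length v"]) auto
qed

text \<open>A window that starts in the first period and is no longer than a period ends within the
  second.\<close>

lemma occurs_in_iter_short:
  assumes "occurs_in w (v\<^sup>\<omega>)" "v \<noteq> []" "length w \<le> length v"
  shows "sublist w (v @ v)"
proof -
  obtain i where i: "i < length v" "subsequence (v\<^sup>\<omega>) i (i + length w) = w"
    using occurs_in_iter[OF assms(1,2)] .
  have "w = take (length w) (drop i (v @ v))"
  proof (rule nth_equalityI)
    fix j assume j: "j < length w"
    have "w ! j = (v\<^sup>\<omega>) (i + j)"
      using j by (subst i(2)[symmetric]) simp
    also have "\<dots> = (v @ v) ! (i + j)"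
      using assms i(1) j by (auto simp: nth_append mod_if)
    finally show "w ! j = take (length w) (drop i (v @ v)) ! j"
      using assms i(1) j by (simp del: drop_append)
  qed (use assms i in simp)
  then show ?thesis
    by (metis sublist_drop sublist_order.order_trans sublist_take)
qed

subsection \<open>Words that pass through runs of zeros\<close>

lemma sublist_append_split:
  assumes "sublist w (xs @ ys)"
  obtains w1 w2 where "w = w1 @ w2" "sublist w1 xs" "sublist w2 ys"
proof -
  consider "sublist w xs" | "sublist w ys" | w1 w2 where "w = w1 @ w2" "suffix w1 xs" "prefix w2 ys"
    using assms unfolding sublist_append by blast
  then show thesis
  proof cases
    case 1
    then show ?thesis by (intro that[of w "[]"]) auto
  next
    case 2
    then show ?thesis by (intro that[of "[]" w]) auto
  next
    case 3
    then show ?thesis by (intro that[of w1 w2]) auto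
  qed
qed

lemma sublist_zeros:
  assumes "sublist w (zeros n)"
  obtains m where "w = zeros m"
proof -
  have "set w \<subseteq> {False}"
    using set_mono_sublist[OF assms] by auto
  then have "w = zeros (length w)"
    by (intro replicate_eqI) auto
  then show thesis by (rule that)
qed

lemma sublist_padded:
  assumes "sublist w (zeros a @ u @ zeros c)"
  obtains a' s c' where "w = zeros a' @ s @ zeros c'" "sublist s u"
proof -
  obtain w1 w' where w: "w = w1 @ w'" "sublist w1 (zeros a)" "sublist w' (u @ zeros c)"
    using sublist_append_split[OF assms] .
  obtain s w3 where w': "w' = s @ w3" "sublist s u" "sublist w3 (zeros c)"
    using sublist_append_split[OF w(3)] .
  obtain a' where "w1 = zeros a'"
    using sublist_zeros[OF w(2)] .
  moreover obtain c' where "w3 = zeros c'"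
    using sublist_zeros[OF w'(3)] .
  ultimately show thesis
    using w(1) w'(1,2) by (intro that[of a' s c']) auto
qed

text \<open>If \<open>w\<close> starts in \<open>xs\<close>, then its part beyond \<open>xs\<close>
  is too short to leave \<open>ys\<close>.\<close>

lemma sublist_append3_short:
  assumes "sublist w (xs @ ys @ zs)" "length w \<le> length ys"
  shows "sublist w (xs @ ys) \<or> sublist w (ys @ zs)"
proof -
  consider "sublist w xs" | "sublist w (ys @ zs)"
    | w1 w2 where "w = w1 @ w2" "suffix w1 xs" "prefix w2 (ys @ zs)"
    using assms(1) unfolding sublist_append[of w xs] by blast
  then show ?thesis
  proof cases
    case 3
    moreover have "length w2 \<le> length ys"
      using 3(1) assms(2) by simp
    ultimately have "prefix w2 ys"
      using prefix_length_prefix[of w2 "ys @ zs" ys] by simp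
    then show ?thesis
      using 3 unfolding sublist_append by blast
  qed (simp_all add: sublist_append)
qed

lemma sublist_two_words:
  assumes "sublist w (zeros a @ u @ zeros b @ v @ zeros c)"
  obtains a' s b' p c' where "w = zeros a' @ s @ zeros b' @ p @ zeros c'" "sublist s u" "sublist p v"
proof -
  obtain w1 w2 where w: "w = w1 @ w2" "sublist w1 (zeros a @ u @ zeros b)" "sublist w2 (v @ zeros c)"
    using sublist_append_split[of w "zeros a @ u @ zeros b" "v @ zeros c"] assms by auto
  obtain a' s b' where w1: "w1 = zeros a' @ s @ zeros b'" "sublist s u"
    using sublist_padded[OF w(2)] .
  obtain b'' p c' where w2: "w2 = zeros b'' @ p @ zeros c'" "sublist p v"
    using sublist_padded[of w2 0 v c] w(3) by auto
  \<comment> \<open>The cut is made between the gap and \<open>v\<close>; the zeros on its two sides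
    merge, so three runs suffice.\<close>
  show thesis
    using w(1) w1 w2 by (intro that[of a' s "b' + b''" p c']) (auto simp: replicate_add)
qed

lemma sublist_two_words_short:
  assumes "sublist w (zeros a @ u @ zeros b @ v @ zeros c)" "length w \<le> b"
  obtains a' s c' where "w = zeros a' @ s @ zeros c'" "sublist s u \<or> sublist s v"
proof -
  have "sublist w (zeros a @ u @ zeros b) \<or> sublist w (zeros b @ v @ zeros c)"
    using sublist_append3_short[of w "zeros a @ u" "zeros b" "v @ zeros c"] assms by simp
  then show thesis
    by (elim disjE sublist_padded) (auto intro: that)
qed

subsection \<open>The words of a stage\<close>

lemma zero_word_in_X_stage: "zero_word \<in> X_stage n"
  by (induction n) auto

lemma G_language: "u \<in> G m Y \<Longrightarrow> u \<in> language Y \<and> u \<noteq> []"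
  by (auto simp: G_def language_def from_1_to_1_def)

lemma language_X_stage_0:
  assumes "w \<in> language (X_stage 0)"
  obtains a s c where "w = zeros a @ s @ zeros c" "s \<in> {[], [True]}"
proof -
  obtain a where "occurs_in w zero_word \<or> occurs_in w ((zeros a @ [True]) \<frown> zero_word)"
    using assms by (auto simp: language_def simp del: conc_conc)
  then obtain xs where xs: "occurs_in w (xs \<frown> zero_word)" "xs = [] \<or> xs = zeros a @ [True]"
    by (metis conc_empty)
  then obtain c where c: "sublist w (xs @ zeros c)"
    using occurs_in_conc_zero_word by blast
  have "sublist (xs @ zeros c) (zeros a @ [True] @ zeros c)"
    using xs(2) sublist_append_leftI[of "zeros c" "zeros a @ [True]"] by auto
  with c have "sublist w (zeros a @ [True] @ zeros c)"
    by (rule sublist_order.order_trans)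
  then obtain a' s c' where w: "w = zeros a' @ s @ zeros c'" and s: "sublist s [True]"
    by (rule sublist_padded)
  have "s \<in> {[], [True]}"
    using s by (auto simp: sublist_Cons_right prefix_Cons)
  with w show thesis by (rule that)
qed

text \<open>\<open>two_words\<close> asks only for words of the stage, possibly empty. It thus
  covers old words, the points of \<open>J1_next\<close> and \<open>J2_next\<close>, and short
  windows of periodic points. The lower bounds on \<open>b\<close> and \<open>k\<close> are kept for
  the study of later stages.\<close>

lemma language_X_stage_Suc:
  assumes "w \<in> language (X_stage (Suc n))"
  obtains (two_words) u v a b c where "u \<in> language (X_stage n)" "v \<in> language (X_stage n)"
      "2 ^ (2 * n) \<le> b" "sublist w (zeros a @ u @ zeros b @ v @ zeros c)"
    | (periodic) u k i where "u \<in> language (X_stage n)" "2 ^ (2 * n) \<le> k"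
      "length u + k < length w" "i < length u + k"
      "w = subsequence ((u @ zeros k)\<^sup>\<omega>) i (i + length w)"
proof -
  let ?L = "language (X_stage n)"
  let ?Q = "{(u @ zeros k)\<^sup>\<omega> | u k. 2 ^ (2 * n) \<le> k \<and> u \<in> G (2 ^ n) (X_stage n)}"
  have Nil: "[] \<in> ?L"
    using zero_word_in_X_stage Nil_in_language by blast
  have "w \<in> ?L \<or> w \<in> language (P_next n (X_stage n)) \<or> w \<in> language (J1_next n (X_stage n))
      \<or> w \<in> language (J2_next n (X_stage n))"
    using assms by (auto simp: Y_next_def language_Un language_closure)
  then consider "w \<in> ?L" | "w \<in> language (P_next n (X_stage n))"
    | "w \<in> language (J1_next n (X_stage n))" | "w \<in> language (J2_next n (X_stage n))"
    by blast
  then show thesis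
  proof cases
    case 1
    show thesis
      by (rule two_words[OF 1 Nil order_refl, of 0 0]) simp
  next
    case 2
    then obtain l z where z: "z \<in> ?Q" and "occurs_in w ((shift ^^ l) z)"
      unfolding P_next_def language_def by blast
    then obtain u k where k: "2 ^ (2 * n) \<le> k" and G: "u \<in> G (2 ^ n) (X_stage n)"
      and z_eq: "z = (u @ zeros k)\<^sup>\<omega>"
      by blast
    have u: "u \<in> ?L" "u \<noteq> []"
      using G_language[OF G] by simp_all
    have occ: "occurs_in w ((u @ zeros k)\<^sup>\<omega>)"
      using occurs_in_shift_funpow[OF \<open>occurs_in w ((shift ^^ l) z)\<close>] unfolding z_eq .
    show thesis
    \<comment> \<open>A window no longer than the period lies in two consecutive periods, which is
      \<open>two_words\<close> with \<open>u\<close> taken twice.\<close>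
    proof (cases "length u + k < length w")
      case True
      then show thesis
        using occurs_in_iter[OF occ] u k periodic[of u k]
        by (metis append_is_Nil_conv length_append length_replicate)
    next
      case False
      then have "sublist w ((u @ zeros k) @ (u @ zeros k))"
        using u by (intro occurs_in_iter_short[OF occ]) auto
      then show thesis
        using two_words[OF u(1) u(1) k, of 0 k] by simp
    qed
  next
    case 3
    then obtain a u where u: "u \<in> G (2 ^ n) (X_stage n)" and "occurs_in w ((zeros a @ u) \<frown> zero_word)"
      unfolding language_def J1_next_def by blast
    then obtain c where "sublist w ((zeros a @ u) @ zeros c)"
      using occurs_in_conc_zero_word by blast
    \<comment> \<open>The extra zeros make the tail long enough to serve as the gap before an empty
      second word.\<close>
    then have "sublist w (((zeros a @ u) @ zeros c) @ zeros (2 ^ (2 * n)))"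
      by (rule sublist_append_rightI[THEN sublist_order.order_trans[rotated]])
    then show thesis
      using two_words[of u "[]" "c + 2 ^ (2 * n)" a 0] G_language[OF u] Nil
      by (simp add: replicate_add)
  next
    case 4
    then obtain a b u v where b: "2 ^ (2 * n) \<le> b" and u: "u \<in> G (2 ^ n) (X_stage n)"
      and v: "v \<in> G (2 ^ n) (X_stage n)"
      and "occurs_in w ((zeros a @ u @ zeros b @ v) \<frown> zero_word)"
      unfolding language_def J2_next_def by blast
    then obtain c where "sublist w ((zeros a @ u @ zeros b @ v) @ zeros c)"
      using occurs_in_conc_zero_word by blast
    then show thesis
      using two_words[OF _ _ b, of u v a c] G_language[OF u] G_language[OF v] by simp
  qed
qed

subsection \<open>Counting\<close>

lemma card_language_upto_0: "card (language_upto N (X_stage 0)) \<le> 2 * (N + 1) ^ 2"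
proof -
  let ?S = "{..N} \<times> {[], [True]} \<times> {..N}"
  have "language_upto N (X_stage 0) \<subseteq> (\<lambda>(a, s, c). zeros a @ s @ zeros c) ` ?S"
  proof
    fix w assume "w \<in> language_upto N (X_stage 0)"
    then have w: "w \<in> language (X_stage 0)" "length w \<le> N"
      by (simp_all add: language_upto_def)
    obtain a s c where s: "w = zeros a @ s @ zeros c" "s \<in> {[], [True]}"
      using language_X_stage_0[OF w(1)] .
    show "w \<in> (\<lambda>(a, s, c). zeros a @ s @ zeros c) ` ?S"
      by (rule image_eqI[of _ _ "(a, s, c)"]) (use w s in auto)
  qed
  then have "card (language_upto N (X_stage 0)) \<le> card ?S"
    by (rule surj_card_le[rotated]) simp
  also have "\<dots> = 2 * (N + 1) ^ 2"
    by (simp add: card_cartesian_product power2_eq_square)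
  finally show ?thesis .
qed

lemma card_language_upto_pos: "0 < card (language_upto N (X_stage n))"
proof -
  have "[] \<in> language_upto N (X_stage n)"
    using Nil_in_language zero_word_in_X_stage by (auto simp: language_upto_def)
  then show ?thesis
    using finite_language_upto by (auto simp: card_gt_0_iff)
qed

text \<open>\<open>?f\<close> and \<open>?g\<close> decode the two cases of
  \<open>language_X_stage_Suc\<close>. The counts are \<open>(N + 1) ^ 3\<close> times
  \<open>card ?L ^ 2\<close> and \<open>card ?L\<close>, and the second is at most the first since
  \<open>card ?L\<close> is positive.\<close>

lemma card_language_upto_Suc:
  "card (language_upto N (X_stage (Suc n)))
    \<le> 2 * (N + 1) ^ 3 * card (language_upto N (X_stage n)) ^ 2"
proof -
  let ?L = "language_upto N (X_stage n)"
  let ?f = "\<lambda>(a, s, b, p, c). zeros a @ s @ zeros b @ p @ zeros c"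
  let ?A = "{..N} \<times> ?L \<times> {..N} \<times> ?L \<times> {..N}"
  let ?g = "\<lambda>(u, k, i, l). subsequence ((u @ zeros k)\<^sup>\<omega>) i (i + l)"
  let ?B = "?L \<times> {..N} \<times> {..N} \<times> {..N}"
  have fin: "finite ?A" "finite ?B"
    by (simp_all add: finite_language_upto)
  have "language_upto N (X_stage (Suc n)) \<subseteq> ?f ` ?A \<union> ?g ` ?B"
  proof
    fix w assume "w \<in> language_upto N (X_stage (Suc n))"
    then have w: "w \<in> language (X_stage (Suc n))" and len: "length w \<le> N"
      by (simp_all add: language_upto_def)
    from w show "w \<in> ?f ` ?A \<union> ?g ` ?B"
    proof (cases rule: language_X_stage_Suc)
      case (two_words u v a b c)
      obtain a' s b' p c' where eq: "w = zeros a' @ s @ zeros b' @ p @ zeros c'"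
        and "sublist s u" "sublist p v"
        using sublist_two_words[OF two_words(4)] .
      \<comment> \<open>The code uses \<open>s\<close> and \<open>p\<close>, since \<open>u\<close>
        and \<open>v\<close> may be longer than \<open>N\<close>.\<close>
      then have "s \<in> ?L" "p \<in> ?L"
        using two_words(1,2) len by (auto simp: language_upto_def intro: sublist_in_language)
      then have "w \<in> ?f ` ?A"
        using len eq by (intro image_eqI[of _ _ "(a', s, b', p, c')"]) auto
      then show ?thesis by blast
    next
      case (periodic u k i)
      then have "w \<in> ?g ` ?B"
        using len by (intro image_eqI[of _ _ "(u, k, i, length w)"]) (auto simp: language_upto_def)
      then show ?thesis by blast
    qed
  qed
  then have "card (language_upto N (X_stage (Suc n))) \<le> card (?f ` ?A \<union> ?g ` ?B)"
    using fin by (intro card_mono) auto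
  also have "\<dots> \<le> card (?f ` ?A) + card (?g ` ?B)"
    by (rule card_Un_le)
  also have "\<dots> \<le> card ?A + card ?B"
    by (intro add_mono card_image_le fin)
  also have "\<dots> = (N + 1) ^ 3 * card ?L ^ 2 + (N + 1) ^ 3 * card ?L"
    by (simp add: card_cartesian_product eval_nat_numeral algebra_simps)
  also have "\<dots> \<le> (N + 1) ^ 3 * card ?L ^ 2 + (N + 1) ^ 3 * card ?L ^ 2"
    using card_language_upto_pos[of N n]
    by (intro add_left_mono mult_left_mono self_le_power) auto
  finally show ?thesis by simp
qed

text \<open>With the factor \<open>?M\<close> on the left, the recursion says that each step at most
  squares the quantity, starting from at most \<open>?M ^ 2\<close>.\<close>

lemma card_language_upto_X_stage:
  "2 * (N + 1) ^ 3 * card (language_upto N (X_stage n)) \<le> (2 * (N + 1) ^ 3) ^ (2 ^ (n + 1))"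
  (is "?M * ?c n \<le> _")
proof (induction n)
  case 0
  have "?c 0 \<le> 2 * (N + 1) ^ 2"
    by (rule card_language_upto_0)
  also have "\<dots> \<le> ?M"
    by (intro mult_left_mono power_increasing) auto
  finally have "?M * ?c 0 \<le> ?M * ?M"
    by (rule mult_left_mono) simp
  then show ?case
    by (simp only: power2_eq_square add_0 power_one_right)
next
  case (Suc n)
  have "?M * ?c (Suc n) \<le> ?M * (?M * ?c n ^ 2)"
    by (intro mult_left_mono card_language_upto_Suc) auto
  also have "\<dots> = (?M * ?c n) ^ 2"
    by (simp add: power2_eq_square del: X_stage.simps)
  also have "\<dots> \<le> (?M ^ (2 ^ (n + 1))) ^ 2"
    by (intro power_mono Suc.IH) simp
  also have "\<dots> = ?M ^ (2 ^ (n + 1) * 2)"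
    by (rule power_mult[symmetric])
  also have "2 ^ (n + 1) * 2 = (2 ^ (Suc n + 1) :: nat)"
    by simp
  finally show ?case .
qed

section \<open>Stability of short words and the bound for the limit\<close>

text \<open>By induction on \<open>j\<close>: every new gap is at least as long as \<open>w\<close>,
  so \<open>w\<close> is a padded piece of a single word of the previous stage, and nested paddings
  merge. The \<open>periodic\<close> case cannot occur, as the period is at least
  \<open>2 ^ (2 * m)\<close>.\<close>

lemma language_later_X_stage:
  assumes "w \<in> language (X_stage (m + j))" "length w \<le> 2 ^ (2 * m)"
  obtains a s c where "w = zeros a @ s @ zeros c" "s \<in> language (X_stage m)"
  using assms
proof (induction j arbitrary: w thesis)
  case 0
  then show ?case
    by (metis add_0_right append_Nil append_Nil2 replicate_0)
next
  case (Suc j)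
  have le: "2 ^ (2 * m) \<le> (2 :: nat) ^ (2 * (m + j))"
    by (intro power_increasing) auto
  have "w \<in> language (X_stage (Suc (m + j)))"
    using Suc.prems by simp
  then show ?case
  proof (cases rule: language_X_stage_Suc)
    case (two_words u v a b c)
    then obtain a' s c' where w: "w = zeros a' @ s @ zeros c'" and "sublist s u \<or> sublist s v"
      using sublist_two_words_short le Suc.prems(3) by (metis le_trans)
    then have "s \<in> language (X_stage (m + j))"
      using two_words sublist_in_language by blast
    moreover have "length s \<le> 2 ^ (2 * m)"
      using Suc.prems(3) w by simp
    ultimately obtain a'' s' c'' where "s = zeros a'' @ s' @ zeros c''" "s' \<in> language (X_stage m)"
      using Suc.IH by blast
    then show ?thesis
      using w by (intro Suc.prems(1)[of "a' + a''" s' "c'' + c'"]) (auto simp: replicate_add)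
  next
    case (periodic u k i)
    then have "2 ^ (2 * m) < length w" using le by linarith
    then show ?thesis using Suc.prems(3) by simp
  qed
qed

lemma X_stage_mono: "X_stage n \<subseteq> X_stage (n + j)"
  by (induction j) auto

lemma card_blocks_X_limit:
  assumes "N \<le> 2 ^ (2 * m)"
  shows "card (blocks N X_limit) \<le> (2 * (N + 1) ^ 3) ^ (2 ^ (m + 1))"
proof -
  let ?S = "{..N} \<times> language_upto N (X_stage m) \<times> {..N}"
  have "blocks N X_limit \<subseteq> (\<lambda>(a, s, c). zeros a @ s @ zeros c) ` ?S"
  proof
    fix w assume "w \<in> blocks N X_limit"
    then have len: "length w = N" and "w \<in> language X_limit"
      by (auto simp: blocks_def language_def)
    then obtain n where "w \<in> language (X_stage n)"
      unfolding X_limit_def language_closure language_UN by blast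
    \<comment> \<open>Passing to stage \<open>m + n\<close> avoids a distinction between
      \<open>n < m\<close> and \<open>n \<ge> m\<close>.\<close>
    then have "w \<in> language (X_stage (m + n))"
      using X_stage_mono[of n m] by (auto simp: language_def add.commute)
    then obtain a s c where "w = zeros a @ s @ zeros c" "s \<in> language (X_stage m)"
      using language_later_X_stage len assms by blast
    then show "w \<in> (\<lambda>(a, s, c). zeros a @ s @ zeros c) ` ?S"
      using len by (intro image_eqI[of _ _ "(a, s, c)"]) (auto simp: language_upto_def)
  qed
  then have "card (blocks N X_limit) \<le> card ?S"
    by (rule surj_card_le[rotated]) (simp add: finite_language_upto)
  also have "\<dots> = (N + 1) ^ 2 * card (language_upto N (X_stage m))"
    by (simp add: card_cartesian_product power2_eq_square algebra_simps)
  \<comment> \<open>The factor from the two paddings is absorbed into the one that the squaring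
    bound carries.\<close>
  also have "\<dots> \<le> 2 * (N + 1) ^ 3 * card (language_upto N (X_stage m))"
  proof (rule mult_right_mono)
    have "(N + 1) ^ 2 \<le> (N + 1) ^ 3"
      by (rule power_increasing) auto
    then show "(N + 1) ^ 2 \<le> 2 * (N + 1) ^ 3" by linarith
  qed simp
  also have "\<dots> \<le> (2 * (N + 1) ^ 3) ^ (2 ^ (m + 1))"
    by (rule card_language_upto_X_stage)
  finally show ?thesis .
qed

theorem lemma11:
  shows "topological_entropy X_limit = 0"
proof -
  let ?h = "\<lambda>n. ln (real (card (blocks n X_limit))) / real n"
  have pos: "0 < card (blocks n X_limit)" for n
    using zero_word_in_X_limit by (intro card_blocks_pos) auto
  \<comment> \<open>The limit that defines the entropy exists, so it may be computed along the
    lengths \<open>2 ^ (2 * m)\<close>, the largest that \<open>card_blocks_X_limit\<close> admits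
    for each \<open>m\<close>.\<close>
  have "strict_mono (\<lambda>m. 2 ^ (2 * m) :: nat)"
    by (auto simp: strict_mono_def)
  from LIMSEQ_subseq_LIMSEQ[OF tendsto_topological_entropy this, of X_limit]
  have entropy: "(\<lambda>m. ?h (2 ^ (2 * m))) \<longlonglongrightarrow> topological_entropy X_limit"
    by (simp add: o_def)
  have "(\<lambda>m. ?h (2 ^ (2 * m))) \<longlonglongrightarrow> 0"
  proof (rule tendsto_sandwich)
    show "\<forall>\<^sub>F m in sequentially. 0 \<le> ?h (2 ^ (2 * m))"
      using pos by (auto intro!: always_eventually divide_nonneg_nonneg ln_ge_zero simp: Suc_le_eq)
    show "\<forall>\<^sub>F m in sequentially. ?h (2 ^ (2 * m)) \<le> 2 * (ln 16 + real m * ln 64) / 2 ^ m"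
    proof (intro always_eventually allI)
      fix m
      let ?N = "2 ^ (2 * m) :: nat"
      \<comment> \<open>From \<open>?N + 1 \<le> 2 * ?N\<close>; this makes the logarithm of the
        base linear in \<open>m\<close>.\<close>
      have "2 * (?N + 1) ^ 3 \<le> 2 * (2 * ?N) ^ 3"
        by (intro mult_left_mono power_mono) auto
      also have "2 * (2 * ?N) ^ 3 = 16 * 64 ^ m"
      proof -
        have "?N ^ 3 = (2 ^ 6) ^ m"
          unfolding power_mult[symmetric] by (simp add: mult.commute)
        then show ?thesis
          by (simp add: power_mult_distrib)
      qed
      finally have "2 * (?N + 1) ^ 3 \<le> 16 * 64 ^ m" .
      then have "(2 * (?N + 1) ^ 3) ^ (2 ^ (m + 1)) \<le> (16 * 64 ^ m) ^ (2 ^ (m + 1))"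
        by (rule power_mono) simp
      then have "card (blocks ?N X_limit) \<le> (16 * 64 ^ m) ^ (2 ^ (m + 1))"
        using card_blocks_X_limit[of ?N m] by linarith
      then have "real (card (blocks ?N X_limit)) \<le> (16 * 64 ^ m) ^ (2 ^ (m + 1))"
        by (metis (mono_tags) of_nat_le_iff of_nat_mult of_nat_numeral of_nat_power)
      then have "ln (real (card (blocks ?N X_limit))) \<le> ln ((16 * 64 ^ m) ^ (2 ^ (m + 1)))"
        using pos[of ?N] by (intro ln_mono) auto
      also have "\<dots> = 2 ^ (m + 1) * (ln 16 + real m * ln 64)"
        by (simp add: ln_realpow ln_mult distrib_left)
      finally have "?h ?N \<le> 2 ^ (m + 1) * (ln 16 + real m * ln 64) / real ?N"
        by (rule divide_right_mono) simp
      \<comment> \<open>The exponent is twice the square root of \<open>?N\<close>, so division by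
        \<open>?N\<close> leaves \<open>2 / 2 ^ m\<close>.\<close>
      also have "\<dots> = 2 * (ln 16 + real m * ln 64) / 2 ^ m"
      proof -
        have "real ?N = 2 ^ m * 2 ^ m"
          by (simp add: mult_2 power_add)
        then show ?thesis by simp
      qed
      finally show "?h ?N \<le> 2 * (ln 16 + real m * ln 64) / 2 ^ m" .
    qed
    show "(\<lambda>m. 2 * (ln 16 + real m * ln 64) / 2 ^ m) \<longlonglongrightarrow> 0"
      by real_asymp
  qed simp
  with entropy show ?thesis
    by (rule LIMSEQ_unique)
qed

end
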